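(* Let $\alpha,\beta>0$, $\rho:=\log_2(\alpha+\beta)$, $f,g,\varphi$ as in the context, and assume $g(n)=n^\rho+g_0(n)$ for $n\ge2$, where $g_0(n)=O(n^{\rho-\varepsilon})$ for some $\varepsilon>0$. Then $$f(n)=n^\rho\log_2n+n^\rho P(\log_2n)-Q(n),\qquad n\ge1,$$ where $P$ is a continuous $1$-periodic function and $Q(n)=o(n^\rho)$ as $n\to\infty$. The Mellin transform $g^*(s):=\int_1^\infty g(x)x^{s-1}\,dx$ (defined for $\operatorname{Re}s<-\rho$) extends meromorphically to $\operatorname{Re}s<-\rho+\min(\varepsilon,1)$ with a sole simple pole at $s=-\rho$, and with $\chi_k:=\frac{2k\pi}{\log2}i$ the Fourier coefficients $\widehat P(k):=\int_0^1P(t)e^{-2k\pi it}dt$ are $$\widehat P(k)=\frac{f(1)}{\log2}\int_0^1\frac{1+(\alpha+\beta-1)\varphi(u)}{(1+u)^{\rho+\chi_k+1}}\,du+\begin{cases}\frac1{\log2}g^*(-\rho-\chi_k),&k\ne0,\\ \frac1{\log2}g^*(-\rho)\big|_{\mathrm{FV}}+\frac12,&k=0,\end{cases}$$ where $F(s)|_{\mathrm{FV}}$ denotes the constant term of the Laurent expansion of $F$ at $s$. If moreover $g(n)=n^\rho$ for all even $n\ge2$, then $Q(n)=0$ for all $n\ge1$.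
   Context: Let $(f(n))_{n\ge1}$, $(g(n))_{n\ge2}$ be real sequences with $f(n)=\alpha f(\lfloor n/2\rfloor)+\beta f(\lceil n/2\rceil)+g(n)$ for $n\ge2$; set $g(1):=0$. Let $\varphi$ be the unique continuous function on $[0,1]$ with $\varphi(0)=0$, $\varphi(1)=1$, $\varphi(t)=\frac{\beta}{\alpha+\beta}\varphi(2t)$ on $[0,\frac12]$, $\varphi(t)=\frac{\alpha}{\alpha+\beta}\varphi(2t-1)+\frac{\beta}{\alpha+\beta}$ on $[\frac12,1]$. Extend $g$ to real $x\ge1$ by $g(n+t):=(1-\varphi(t))g(n)+\varphi(t)g(n+1)$ ($n\ge1$, $t\in[0,1]$), and $g(x):=0$ for $0\le x<1$. *)

theory Defs
  imports "HOL-Complex_Analysis.Complex_Analysis" "HOL-Library.Landau_Symbols"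
begin

text \<open>
  On \<open>[0,1]\<close> these conditions determine \<open>\<phi>\<close> uniquely when \<open>\<alpha>, \<beta> > 0\<close>;
  the values of \<open>\<phi>\<close> outside \<open>[0,1]\<close> are never used.
\<close>
definition interpolation_fun :: "real \<Rightarrow> real \<Rightarrow> (real \<Rightarrow> real) \<Rightarrow> bool" where
  "interpolation_fun \<alpha> \<beta> \<phi> \<longleftrightarrow>
     continuous_on {0..1} \<phi> \<and> \<phi> 0 = 0 \<and> \<phi> 1 = 1 \<and>
     (\<forall>t\<in>{0..1/2}. \<phi> t = \<beta> / (\<alpha> + \<beta>) * \<phi> (2 * t)) \<and>
     (\<forall>t\<in>{1/2..1}. \<phi> t = \<alpha> / (\<alpha> + \<beta>) * \<phi> (2 * t - 1) + \<beta> / (\<alpha> + \<beta>))"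

text \<open>
  Here \<open>n = \<lfloor>x\<rfloor>\<close> and \<open>t = frac x \<in> [0,1)\<close>; the case \<open>t = 1\<close> of the interpolation formula is
  consistent with this because \<open>\<phi> 0 = 0\<close> and \<open>\<phi> 1 = 1\<close>.
\<close>
definition interpolate :: "(real \<Rightarrow> real) \<Rightarrow> (nat \<Rightarrow> real) \<Rightarrow> real \<Rightarrow> real" where
  "interpolate \<phi> g x =
     (if x < 1 then 0
      else (1 - \<phi> (frac x)) * g (nat \<lfloor>x\<rfloor>) + \<phi> (frac x) * g (nat \<lfloor>x\<rfloor> + 1))"

definition mellin_integrand :: "(real \<Rightarrow> real) \<Rightarrow> complex \<Rightarrow> real \<Rightarrow> complex" where
  "mellin_integrand h s x = complex_of_real (h x) * complex_of_real x powr (s - 1)"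

definition mellin :: "(real \<Rightarrow> real) \<Rightarrow> complex \<Rightarrow> complex" where
  "mellin h s = integral {1..} (mellin_integrand h s)"

definition chi :: "int \<Rightarrow> complex" where
  "chi k = complex_of_real (2 * of_int k * pi / ln 2) * \<i>"

definition fourier_coeff :: "(real \<Rightarrow> real) \<Rightarrow> int \<Rightarrow> complex" where
  "fourier_coeff P k =
     integral {0..1} (\<lambda>t. complex_of_real (P t) * exp (- 2 * of_int k * of_real pi * \<i> * of_real t))"

definition finite_value :: "(complex \<Rightarrow> complex) \<Rightarrow> complex \<Rightarrow> complex" where
  "finite_value F s = fls_nth (laurent_expansion F s) 0"

end

theory Submission
  imports Defs
begin

text \<open>
  The functional equation of \<open>\<phi>\<close> is made so that the interpolated sequences satisfy
  \<open>f(2x) = 2\<^sup>\<rho> f(x) + g(2x)\<close> for all real \<open>x \<ge> 1\<close>. Hence \<open>u(x) = x\<^bsup>-\<rho>\<^esup> f(x)\<close> satisfies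
  \<open>u(2x) = u(x) + 1 + h(2x)\<close> with \<open>h(x) = x\<^bsup>-\<rho>\<^esup> g(x) - 1\<close>, which is \<open>O(x\<^bsup>-\<delta>\<^esup>)\<close> for
  \<open>\<delta> = min \<epsilon> 1\<close>; the minimum appears because already the interpolation of \<open>n\<^sup>\<rho>\<close> differs from
  \<open>x\<^sup>\<rho>\<close> by \<open>O(x\<^bsup>\<rho>-1\<^esup>)\<close>. Put \<open>H(x) = \<Sum>\<^bsub>j\<ge>0\<^esub> h(2\<^sup>j x)\<close>. Then \<open>u(x) + H(2x) - log\<^sub>2 x\<close> is invariant under
  doubling \<open>x\<close>, so it has the form \<open>P(log\<^sub>2 x)\<close> with \<open>P\<close> periodic, and \<open>Q(n) = n\<^sup>\<rho> H(2n)\<close>.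

  Since \<open>h(x) = H(x) - H(2x)\<close>, the integral over \<open>[1,\<infinity>)\<close> of \<open>h(x) x\<^bsup>s-1\<^esup>\<close> telescopes when \<open>2\<^sup>s = 1\<close>
  to the integral of \<open>H(x) x\<^bsup>s-1\<^esup>\<close> over \<open>[1,2]\<close>; thus the Fourier coefficients of \<open>H(2\<^sup>t)\<close> are
  values of the Mellin transform of \<open>h\<close>. That transform is holomorphic for \<open>Re s < \<delta>\<close>, and
  \<open>g\<^sup>*(s) = h\<^sup>*(s+\<rho>) - 1/(s+\<rho>)\<close>. On \<open>[0,1]\<close> the remaining terms of \<open>P(t)\<close> are the part of \<open>f\<close>
  determined by \<open>f(1)\<close> and the sawtooth \<open>1 - t\<close>, whose \<open>k\<close>-th Fourier coefficient
  \<open>1/(\<chi>\<^sub>k log 2)\<close>, for \<open>k \<noteq> 0\<close>, accounts for the polar term \<open>-1/(s+\<rho>)\<close> at \<open>s = -\<rho> - \<chi>\<^sub>k\<close>.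
\<close>

section \<open>Continuity on unit intervals\<close>

lemma continuous_on_unit_intervals:
  fixes F :: "real \<Rightarrow> 'a :: topological_space"
  assumes "closed S" and "\<And>n :: int. continuous_on (S \<inter> {of_int n..of_int n + 1}) F"
  shows "continuous_on S F"
  unfolding continuous_on_eq_continuous_within
proof
  fix x assume "x \<in> S"
  define n where "n = \<lfloor>x\<rfloor>"
  define U where "U = {of_int n - 1..of_int n + 1 :: real}"
  have x: "x \<in> {of_int n - 1<..<of_int n + 1}"
    unfolding n_def by (simp, linarith)
  have "continuous_on (S \<inter> {of_int (n - 1)..of_int (n - 1) + 1} \<union> S \<inter> {of_int n..of_int n + 1}) F"
    by (intro continuous_on_closed_Un closed_Int closed_atLeastAtMost assms)
  also have "S \<inter> {of_int (n - 1)..of_int (n - 1) + 1} \<union> S \<inter> {of_int n..of_int n + 1} = S \<inter> U"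
    unfolding U_def by auto
  finally have "continuous (at x within S \<inter> U) F"
    using x \<open>x \<in> S\<close> by (auto simp: continuous_on_eq_continuous_within U_def)
  moreover have "at x within S \<inter> U = at x within S"
    by (rule at_within_nhd[OF x]) (auto simp: U_def)
  ultimately show "continuous (at x within S) F"
    by simp
qed

lemma continuous_on_frac_compose:
  fixes p :: "real \<Rightarrow> 'a :: topological_space"
  assumes "continuous_on {0..1} p" and "p 0 = p 1"
  shows "continuous_on UNIV (\<lambda>t. p (frac t))"
proof (rule continuous_on_unit_intervals)
  fix n :: int
  have "continuous_on {of_int n..of_int n + 1} (\<lambda>t. p (t - of_int n))"
    by (rule continuous_on_compose2[OF assms(1)]) (auto intro!: continuous_intros)
  moreover have "p (t - of_int n) = p (frac t)" if "t \<in> {of_int n..of_int n + 1}" for t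
  proof (cases "t = of_int n + 1")
    case True
    hence "frac t = 0" by (simp add: frac_eq_0_iff)
    thus ?thesis using True assms(2) by simp
  next
    case False
    hence "\<lfloor>t\<rfloor> = n" using that by (auto simp: floor_eq_iff)
    thus ?thesis by (simp add: frac_def)
  qed
  ultimately show "continuous_on (UNIV \<inter> {of_int n..of_int n + 1}) (\<lambda>t. p (frac t))"
    by (auto intro: continuous_on_eq)
qed simp

section \<open>Mellin transforms on a left half-plane\<close>

lemma
  fixes h :: "real \<Rightarrow> complex"
  assumes continuous: "continuous_on {a..} h"
    and bound: "\<And>x. x \<ge> a \<Longrightarrow> norm (h x) \<le> C * x powr e"
    and "e < -1" and "a > 0"
  shows absolutely_integrable_powr_bound: "h absolutely_integrable_on {a..}"
    and norm_integral_powr_bound: "norm (integral {a..} h) \<le> C * a powr (e + 1) / (-e - 1)"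
proof -
  have majorant: "((\<lambda>x. C * x powr e) has_integral C * (-(a powr (e + 1)) / (e + 1))) {a..}"
    using has_integral_powr_to_inf[of e a] \<open>e < -1\<close> \<open>a > 0\<close>
    by (intro has_integral_mult_right) auto
  have measurable: "h \<in> borel_measurable (lebesgue_on {a..})"
    by (intro continuous_imp_measurable_on_sets_lebesgue continuous) auto
  show "h absolutely_integrable_on {a..}"
    by (rule measurable_bounded_by_integrable_imp_absolutely_integrable
          [OF measurable _ has_integral_integrable[OF majorant]])
       (use bound in auto)
  have "norm (integral {a..} h) \<le> C * (-(a powr (e + 1)) / (e + 1))"
    by (rule integral_norm_bound_integral'[OF _ measurable _ majorant]) (use bound in auto)
  thus "norm (integral {a..} h) \<le> C * a powr (e + 1) / (-e - 1)"
    using \<open>e < -1\<close> by (simp add: field_simps)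
qed

lemma integral_powr_tail_bound:
  fixes h :: "real \<Rightarrow> complex"
  assumes continuous: "continuous_on {a..} h"
    and bound: "\<And>x. x \<ge> a \<Longrightarrow> norm (h x) \<le> C * x powr e"
    and "e < -1" and "a > 0" and "N \<ge> a"
  shows "norm (integral {a..} h - integral {a..N} h) \<le> C * N powr (e + 1) / (-e - 1)"
proof -
  have tail: "continuous_on {N..} h" "\<And>x. x \<ge> N \<Longrightarrow> norm (h x) \<le> C * x powr e" "N > 0"
    using continuous_on_subset[OF continuous, of "{N..}"] bound \<open>a > 0\<close> \<open>N \<ge> a\<close> by auto
  have "(h has_integral integral {a..N} h) {a..N}"
    by (intro integrable_integral integrable_continuous_interval
        continuous_on_subset[OF continuous]) auto
  moreover have "(h has_integral integral {N..} h) {N..}"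
    using absolutely_integrable_powr_bound[OF tail(1,2) \<open>e < -1\<close> tail(3)]
    by (simp add: integrable_integral set_lebesgue_integral_eq_integral(1))
  moreover have "negligible ({a..N} \<inter> {N..})"
    by (rule negligible_subset[of "{N}"]) auto
  ultimately have "(h has_integral integral {a..N} h + integral {N..} h) ({a..N} \<union> {N..})"
    by (rule has_integral_Un)
  moreover have "{a..N} \<union> {N..} = {a..}"
    using \<open>N \<ge> a\<close> by auto
  ultimately have "integral {a..} h - integral {a..N} h = integral {N..} h"
    by (simp add: integral_unique)
  thus ?thesis
    using norm_integral_powr_bound[OF tail(1,2) \<open>e < -1\<close> tail(3)] by simp
qed

lemma continuous_on_mellin_integrand:
  assumes "continuous_on A h" and "A \<subseteq> {0<..}"
  shows "continuous_on A (mellin_integrand h s)"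
  unfolding mellin_integrand_def using assms
  by (intro continuous_intros) (auto simp: complex_nonpos_Reals_iff)

lemma norm_mellin_integrand:
  "x > 0 \<Longrightarrow> norm (mellin_integrand h s x) = \<bar>h x\<bar> * x powr (Re s - 1)"
  by (simp add: mellin_integrand_def norm_mult norm_powr_real_powr)

lemma mellin_integrand_powr_mult:
  assumes "x > 0"
  shows "mellin_integrand (\<lambda>x. x powr a * h x) s x = mellin_integrand h (s + of_real a) x"
proof -
  have "complex_of_real x powr (s + of_real a - 1) = of_real x powr (of_real a + (s - 1))"
    by (simp add: algebra_simps)
  also have "\<dots> = of_real (x powr a) * of_real x powr (s - 1)"
    using assms by (subst powr_add) (simp add: powr_of_real)
  finally show ?thesis
    by (simp add: mellin_integrand_def)
qed

lemma holomorphic_truncated_mellin: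
  assumes cont: "continuous_on {a..b} h" and "a > 0"
  shows "(\<lambda>s. integral {a..b} (mellin_integrand h s)) holomorphic_on UNIV"
proof -
  have "(\<lambda>s. integral (cbox a b) (mellin_integrand h s)) holomorphic_on UNIV"
  proof (rule leibniz_rule_holomorphic
      [where fx = "\<lambda>s x. of_real (h x) * (Ln (of_real x) * of_real x powr (s - 1))"])
    fix s :: complex and x :: real
    assume "x \<in> cbox a b"
    hence "((\<lambda>s. of_real x powr (s - 1)) has_field_derivative
        Ln (of_real x) * of_real x powr (s - 1) * 1) (at s)"
      using \<open>a > 0\<close>
      by (intro DERIV_chain2[OF has_field_derivative_powr_right]) (auto intro!: derivative_eq_intros)
    thus "((\<lambda>s. mellin_integrand h s x) has_field_derivative
        of_real (h x) * (Ln (of_real x) * of_real x powr (s - 1))) (at s within UNIV)"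
      unfolding mellin_integrand_def
      by (auto intro!: DERIV_cmult)
  next
    fix s
    show "mellin_integrand h s integrable_on cbox a b"
      using \<open>a > 0\<close>
      by (auto intro!: integrable_continuous_interval continuous_on_mellin_integrand[OF cont])
  next
    have "continuous_on (UNIV \<times> cbox a b) (\<lambda>p :: complex \<times> real. h (snd p))"
      by (rule continuous_on_compose2[OF cont]) (auto intro!: continuous_intros)
    thus "continuous_on (UNIV \<times> cbox a b)
        (\<lambda>(s, x). of_real (h x) * (Ln (of_real x) * of_real x powr (s - 1)))"
      unfolding case_prod_unfold using \<open>a > 0\<close>
      by (intro continuous_intros) (auto simp: complex_nonpos_Reals_iff)
  qed auto
  thus ?thesis by simp
qed

locale powr_bigo =
  fixes h :: "real \<Rightarrow> real" and \<sigma> :: real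
  assumes continuous: "continuous_on {1..} h"
    and bigo: "h \<in> O(\<lambda>x. x powr -\<sigma>)"
begin

lemma powr_bound:
  obtains C where "C \<ge> 0" and "\<And>x. x \<ge> 1 \<Longrightarrow> \<bar>h x\<bar> \<le> C * x powr -\<sigma>"
proof -
  obtain c where "\<forall>\<^sub>F x in at_top. norm (h x) \<le> c * norm (x powr -\<sigma>)"
    using landau_o.bigE[OF bigo] by blast
  then obtain X where X: "\<And>x. x \<ge> X \<Longrightarrow> \<bar>h x\<bar> \<le> c * x powr -\<sigma>"
    by (auto simp: eventually_at_top_linorder)
  have "compact ((\<lambda>x. h x * x powr \<sigma>) ` {1..X})"
    by (intro compact_continuous_image continuous_intros continuous_on_subset[OF continuous]) auto
  then obtain B where B: "\<forall>x\<in>{1..X}. \<bar>h x * x powr \<sigma>\<bar> \<le> B"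
    by (auto simp: bounded_iff dest!: compact_imp_bounded)
  have "\<bar>h x\<bar> \<le> max c B * x powr -\<sigma>" if "x \<ge> 1" for x
  proof (cases "x \<ge> X")
    case True
    have "c * x powr -\<sigma> \<le> max c B * x powr -\<sigma>"
      by (intro mult_right_mono) auto
    with X[OF True] show ?thesis by linarith
  next
    case False
    hence "\<bar>h x\<bar> * x powr \<sigma> \<le> max c B"
      using B that by (auto simp: abs_mult max.coboundedI2)
    thus ?thesis
      using that by (simp add: powr_minus field_simps)
  qed
  moreover from this[of 1] have "max c B \<ge> 0" by simp
  ultimately show thesis using that by blast
qed

lemma continuous_on_mellin_integrand_half_line: "continuous_on {1..} (mellin_integrand h s)"
  by (rule continuous_on_mellin_integrand[OF continuous]) auto

lemma mellin_integrand_bound: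
  obtains C where
    "\<And>s x. Re s \<le> a \<Longrightarrow> x \<ge> 1 \<Longrightarrow> norm (mellin_integrand h s x) \<le> C * x powr (a - \<sigma> - 1)"
proof -
  obtain C where C: "C \<ge> 0" "\<And>x. x \<ge> 1 \<Longrightarrow> \<bar>h x\<bar> \<le> C * x powr -\<sigma>"
    using powr_bound by blast
  have "norm (mellin_integrand h s x) \<le> C * x powr (a - \<sigma> - 1)"
    if "Re s \<le> a" "x \<ge> 1" for s x
  proof -
    have "norm (mellin_integrand h s x) \<le> (C * x powr -\<sigma>) * x powr (a - 1)"
      using that C by (auto simp: norm_mellin_integrand intro!: mult_mono powr_mono)
    thus ?thesis
      by (simp add: algebra_simps flip: powr_add)
  qed
  thus thesis using that by blast
qed

lemma mellin_absolutely_integrable: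
  assumes "Re s < \<sigma>"
  shows "mellin_integrand h s absolutely_integrable_on {1..}"
proof -
  obtain C where C: "\<And>t x. Re t \<le> Re s \<Longrightarrow> x \<ge> 1 \<Longrightarrow>
      norm (mellin_integrand h t x) \<le> C * x powr (Re s - \<sigma> - 1)"
    using mellin_integrand_bound by blast
  show ?thesis
    by (rule absolutely_integrable_powr_bound[OF continuous_on_mellin_integrand_half_line C])
       (use assms in auto)
qed

lemma uniform_limit_truncated_mellin:
  assumes "a < \<sigma>"
  shows "uniform_limit {s. Re s \<le> a} (\<lambda>N s. integral {1..N} (mellin_integrand h s)) (mellin h) at_top"
proof (rule uniform_limitI)
  fix r :: real assume r: "r > 0"
  obtain C where C: "\<And>s x. Re s \<le> a \<Longrightarrow> x \<ge> 1 \<Longrightarrow>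
      norm (mellin_integrand h s x) \<le> C * x powr (a - \<sigma> - 1)"
    using mellin_integrand_bound by blast
  have "((\<lambda>N. C * N powr (a - \<sigma>) / (\<sigma> - a)) \<longlongrightarrow> C * 0 / (\<sigma> - a)) at_top"
    using assms by (intro tendsto_intros tendsto_neg_powr filterlim_ident) auto
  hence "\<forall>\<^sub>F N in at_top. C * N powr (a - \<sigma>) / (\<sigma> - a) < r"
    using r by (intro order_tendstoD(2)) auto
  thus "\<forall>\<^sub>F N in at_top. \<forall>s\<in>{s. Re s \<le> a}.
      dist (integral {1..N} (mellin_integrand h s)) (mellin h s) < r"
    using eventually_ge_at_top[of 1]
  proof eventually_elim
    case (elim N)
    show ?case
    proof
      fix s assume "s \<in> {s. Re s \<le> a}"
      hence "norm (mellin h s - integral {1..N} (mellin_integrand h s))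
          \<le> C * N powr (a - \<sigma>) / (\<sigma> - a)"
        using integral_powr_tail_bound[OF continuous_on_mellin_integrand_half_line C _ _ elim(2)] assms
        by (simp add: mellin_def)
      thus "dist (integral {1..N} (mellin_integrand h s)) (mellin h s) < r"
        using elim(1) by (simp add: dist_norm norm_minus_commute)
    qed
  qed
qed

lemma tendsto_truncated_mellin:
  assumes "Re s < \<sigma>"
  shows "((\<lambda>N. integral {1..N} (mellin_integrand h s)) \<longlongrightarrow> mellin h s) at_top"
  using tendsto_uniform_limitI[OF uniform_limit_truncated_mellin[OF assms]] by simp

lemma holomorphic_mellin: "mellin h holomorphic_on {s. Re s < \<sigma>}"
proof (rule holomorphic_uniform_sequence
    [where f = "\<lambda>n s. integral {1..real n} (mellin_integrand h s)"])
  show "open {s. Re s < \<sigma>}"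
    by (simp add: open_halfspace_Re_lt)
  show "(\<lambda>s. integral {1..real n} (mellin_integrand h s)) holomorphic_on {s. Re s < \<sigma>}" for n
    by (rule holomorphic_on_subset[OF holomorphic_truncated_mellin])
       (auto intro: continuous_on_subset[OF continuous])
next
  fix z assume "z \<in> {s. Re s < \<sigma>}"
  then obtain a where a: "Re z < a" "a < \<sigma>"
    using dense by auto
  have ball: "cball z (a - Re z) \<subseteq> {s. Re s \<le> a}"
  proof
    fix s assume "s \<in> cball z (a - Re z)"
    thus "s \<in> {s. Re s \<le> a}"
      using abs_Re_le_cmod[of "z - s"] by (auto simp: dist_norm)
  qed
  have "uniform_limit {s. Re s \<le> a}
      (\<lambda>n s. integral {1..real n} (mellin_integrand h s)) (mellin h) sequentially"
    by (rule filterlim_compose[OF uniform_limit_truncated_mellin[OF a(2)] filterlim_real_sequentially])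
  thus "\<exists>d>0. cball z d \<subseteq> {s. Re s < \<sigma>} \<and> uniform_limit (cball z d)
      (\<lambda>n s. integral {1..real n} (mellin_integrand h s)) (mellin h) sequentially"
    using a ball by (intro exI[of _ "a - Re z"]) (auto intro: uniform_limit_on_subset)
qed

end

lemma powr_bigo_one: "powr_bigo (\<lambda>_. 1) 0"
proof
  have "\<forall>\<^sub>F x :: real in at_top. norm (1 :: real) \<le> 1 * norm (x powr - 0)"
    using eventually_gt_at_top[of "0 :: real"] by eventually_elim simp
  thus "(\<lambda>_. 1) \<in> O(\<lambda>x :: real. x powr - 0)"
    by (rule landau_o.bigI[rotated]) simp
qed simp

lemma mellin_one:
  assumes "Re s < 0"
  shows "mellin (\<lambda>_. 1) s = - 1 / s"
proof -
  have s: "s \<noteq> 0" using assms by auto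
  have truncated: "integral {1..N} (mellin_integrand (\<lambda>_. 1) s) = of_real N powr s / s - 1 / s"
    if "N \<ge> 1" for N
  proof -
    have "(mellin_integrand (\<lambda>_. 1) s has_integral
        (of_real N powr s / s - of_real 1 powr s / s)) {1..N}"
    proof (rule fundamental_theorem_of_calculus[OF that])
      fix x :: real assume "x \<in> {1..N}"
      hence "((\<lambda>z. z powr s / s) has_field_derivative mellin_integrand (\<lambda>_. 1) s x) (at (of_real x))"
        using s by (auto intro!: derivative_eq_intros has_field_derivative_powr
            simp: mellin_integrand_def complex_nonpos_Reals_iff)
      from has_vector_derivative_real_field[OF this]
      show "((\<lambda>x. of_real x powr s / s) has_vector_derivative mellin_integrand (\<lambda>_. 1) s x)
          (at x within {1..N})" .
    qed
    thus ?thesis by (simp add: integral_unique)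
  qed
  have "((\<lambda>N. complex_of_real N powr s) \<longlongrightarrow> 0) at_top"
    using assms by (intro tendsto_neg_powr_complex_of_real filterlim_ident)
  hence "((\<lambda>N. of_real N powr s / s - 1 / s) \<longlongrightarrow> 0 / s - 1 / s) at_top"
    using s by (intro tendsto_intros) auto
  moreover have "\<forall>\<^sub>F N in at_top.
      of_real N powr s / s - 1 / s = integral {1..N} (mellin_integrand (\<lambda>_. 1) s)"
    using eventually_ge_at_top[of 1] by eventually_elim (simp add: truncated)
  ultimately have "((\<lambda>N. integral {1..N} (mellin_integrand (\<lambda>_. 1) s)) \<longlongrightarrow> 0 / s - 1 / s) at_top"
    by (rule Lim_transform_eventually)
  moreover have "((\<lambda>N. integral {1..N} (mellin_integrand (\<lambda>_. 1) s)) \<longlongrightarrow> mellin (\<lambda>_. 1) s) at_top"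
    by (rule powr_bigo.tendsto_truncated_mellin[OF powr_bigo_one assms])
  ultimately show ?thesis
    using tendsto_unique[OF trivial_limit_at_top_linorder] by fastforce
qed

section \<open>Subtracting a simple pole\<close>

lemma has_laurent_expansion_minus_simple_pole:
  assumes "M analytic_on {z}"
  shows "(\<lambda>w. M (z + w) - 1 / w) has_laurent_expansion fps_to_fls (fps_expansion M z) - fls_X_inv"
proof -
  have "(\<lambda>w. M (z + w)) has_laurent_expansion fps_to_fls (fps_expansion M z)"
    by (intro has_laurent_expansion_fps analytic_at_imp_has_fps_expansion assms)
  hence "(\<lambda>w. M (z + w) - inverse w) has_laurent_expansion
      fps_to_fls (fps_expansion M z) - fls_X_inv"
    by (intro laurent_expansion_intros)
  thus ?thesis
    by (simp add: field_simps)
qed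

lemma
  assumes "M analytic_on {z}"
  shows is_pole_minus_simple_pole: "is_pole (\<lambda>s. M s - 1 / (s - z)) z"
    and zorder_minus_simple_pole: "zorder (\<lambda>s. M s - 1 / (s - z)) z = -1"
    and finite_value_minus_simple_pole: "finite_value (\<lambda>s. M s - 1 / (s - z)) z = M z"
proof -
  define L where "L = fps_to_fls (fps_expansion M z) - fls_X_inv"
  have L: "(\<lambda>w. M (z + w) - 1 / (z + w - z)) has_laurent_expansion L"
    using has_laurent_expansion_minus_simple_pole[OF assms] by (simp add: L_def)
  have "fls_subdegree L = -1"
    by (rule fls_subdegree_eqI) (auto simp: L_def)
  thus "is_pole (\<lambda>s. M s - 1 / (s - z)) z" and "zorder (\<lambda>s. M s - 1 / (s - z)) z = -1"
    using has_laurent_expansion_imp_is_pole[OF L] has_laurent_expansion_zorder[OF L] by force+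
  show "finite_value (\<lambda>s. M s - 1 / (s - z)) z = M z"
    unfolding finite_value_def laurent_expansion_eqI[OF L]
    by (simp add: L_def fps_expansion_def)
qed

section \<open>Meromorphic extension of Mellin transforms\<close>

locale powr_decaying = powr_bigo +
  assumes decay_pos: "\<sigma> > 0"
begin

definition mellin_extension :: "real \<Rightarrow> complex \<Rightarrow> complex" where
  "mellin_extension a s = mellin h (s + of_real a) - 1 / (s + of_real a)"

lemma
  assumes u: "\<And>x. x \<ge> 1 \<Longrightarrow> u x = x powr a * (1 + h x)" and s: "Re s < - a"
  shows mellin_powr_times_one_plus_absolutely_integrable:
      "mellin_integrand u s absolutely_integrable_on {1..}"
    and mellin_powr_times_one_plus: "mellin u s = mellin_extension a s"
proof -
  define I where
    "I = (\<lambda>x. mellin_integrand h (s + of_real a) x + mellin_integrand (\<lambda>_. 1) (s + of_real a) x)"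
  have I: "I x = mellin_integrand u s x" if "x \<in> {1..}" for x
  proof -
    have "mellin_integrand u s x = mellin_integrand (\<lambda>x. x powr a * (1 + h x)) s x"
      using u that by (simp add: mellin_integrand_def)
    also have "\<dots> = mellin_integrand (\<lambda>x. 1 + h x) (s + of_real a) x"
      using that by (intro mellin_integrand_powr_mult) simp
    also have "\<dots> = I x"
      by (simp add: I_def mellin_integrand_def algebra_simps)
    finally show ?thesis ..
  qed
  have integrable_h: "mellin_integrand h (s + of_real a) absolutely_integrable_on {1..}"
    by (rule mellin_absolutely_integrable) (use s decay_pos in simp)
  have integrable_1: "mellin_integrand (\<lambda>_. 1) (s + of_real a) absolutely_integrable_on {1..}"
    by (rule powr_bigo.mellin_absolutely_integrable[OF powr_bigo_one]) (use s in simp)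
  have "I absolutely_integrable_on {1..}"
    unfolding I_def by (rule set_integral_add(1)[OF integrable_h integrable_1])
  also have "?this \<longleftrightarrow> mellin_integrand u s absolutely_integrable_on {1..}"
    by (intro set_integrable_cong refl I)
  finally show "mellin_integrand u s absolutely_integrable_on {1..}" .
  have "mellin u s = integral {1..} I"
    unfolding mellin_def using I by (intro integral_cong) auto
  also have "\<dots> = mellin h (s + of_real a) + mellin (\<lambda>_. 1) (s + of_real a)"
    unfolding I_def mellin_def
    using integrable_h integrable_1 by (simp add: integral_add set_lebesgue_integral_eq_integral(1))
  also have "\<dots> = mellin_extension a s"
    using mellin_one[of "s + of_real a"] s by (simp add: mellin_extension_def)
  finally show "mellin u s = mellin_extension a s" .
qed

lemma analytic_shifted_mellin:
  "(\<lambda>s. mellin h (s + of_real a)) analytic_on {s. Re s < - a + \<sigma>}"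
proof -
  have "(mellin h \<circ> (\<lambda>s. s + of_real a)) holomorphic_on {s. Re s < - a + \<sigma>}"
    by (rule holomorphic_on_compose_gen[OF _ holomorphic_mellin]) (auto intro!: holomorphic_intros)
  thus ?thesis
    by (simp only: o_def analytic_on_open open_halfspace_Re_lt)
qed

lemma holomorphic_mellin_extension:
  "mellin_extension a holomorphic_on {s. Re s < - a + \<sigma>} - {- of_real a}"
  unfolding mellin_extension_def
  by (intro holomorphic_intros
        holomorphic_on_subset[OF analytic_imp_holomorphic[OF analytic_shifted_mellin]])
     (auto simp: eq_neg_iff_add_eq_0)

lemma meromorphic_mellin_extension:
  "mellin_extension a meromorphic_on {s. Re s < - a + \<sigma>}"
  unfolding mellin_extension_def
  by (intro meromorphic_intros analytic_on_imp_meromorphic_on[OF analytic_shifted_mellin])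

lemma is_pole_mellin_extension: "is_pole (mellin_extension a) (- of_real a)"
  and zorder_mellin_extension: "zorder (mellin_extension a) (- of_real a) = -1"
  and finite_value_mellin_extension: "finite_value (mellin_extension a) (- of_real a) = mellin h 0"
proof -
  have analytic: "(\<lambda>s. mellin h (s + of_real a)) analytic_on {- of_real a}"
    by (rule analytic_on_subset[OF analytic_shifted_mellin]) (use decay_pos in simp)
  have "mellin_extension a = (\<lambda>s. mellin h (s + of_real a) - 1 / (s - (- of_real a)))"
    by (simp add: fun_eq_iff mellin_extension_def)
  thus "is_pole (mellin_extension a) (- of_real a)"
    and "zorder (mellin_extension a) (- of_real a) = -1"
    and "finite_value (mellin_extension a) (- of_real a) = mellin h 0"
    using is_pole_minus_simple_pole[OF analytic] zorder_minus_simple_pole[OF analytic]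
      finite_value_minus_simple_pole[OF analytic] by simp_all
qed

end

section \<open>Dyadic sums\<close>

lemma one_le_two_power_mult: "x \<ge> 1 \<Longrightarrow> 1 \<le> 2 ^ n * (x :: real)"
  using mult_mono[of 1 "2 ^ n" 1 x] by simp

context powr_decaying
begin

definition dyadic_sum :: "real \<Rightarrow> real" where
  "dyadic_sum x = (\<Sum>j. h (2 ^ j * x))"

lemma summable_geometric_powr: "summable (\<lambda>j::nat. C * (2 powr -\<sigma>) ^ j)"
proof -
  have "2 powr -\<sigma> < (1 :: real)"
    using powr_less_mono[of "-\<sigma>" 0 2] decay_pos by simp
  thus ?thesis
    by (intro summable_mult summable_geometric) auto
qed

lemma dyadic_term_bound:
  obtains C where "C \<ge> 0"
    and "\<And>x j. x \<ge> 1 \<Longrightarrow> \<bar>h (2 ^ j * x)\<bar> \<le> C * (2 powr -\<sigma>) ^ j * x powr -\<sigma>"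
proof -
  obtain C where C: "C \<ge> 0" "\<And>x. x \<ge> 1 \<Longrightarrow> \<bar>h x\<bar> \<le> C * x powr -\<sigma>"
    using powr_bound by blast
  have "\<bar>h (2 ^ j * x)\<bar> \<le> C * (2 powr -\<sigma>) ^ j * x powr -\<sigma>" if x: "x \<ge> 1" for x j
  proof -
    have "\<bar>h (2 ^ j * x)\<bar> \<le> C * (2 ^ j * x) powr -\<sigma>"
      by (intro C(2) one_le_two_power_mult x)
    also have "(2 ^ j * x) powr -\<sigma> = (2 powr -\<sigma>) ^ j * x powr -\<sigma>"
      using x by (simp add: powr_mult powr_power powr_powr mult.commute flip: powr_realpow)
    finally show ?thesis by (simp add: mult_ac)
  qed
  with C(1) show thesis by (rule that)
qed

lemma summable_dyadic:
  assumes "x \<ge> 1"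
  shows "summable (\<lambda>j. h (2 ^ j * x))"
proof -
  obtain C where "C \<ge> 0"
    "\<And>x j. x \<ge> 1 \<Longrightarrow> \<bar>h (2 ^ j * x)\<bar> \<le> C * (2 powr -\<sigma>) ^ j * x powr -\<sigma>"
    using dyadic_term_bound by blast
  thus ?thesis
    using assms
    by (intro summable_comparison_test'[OF summable_mult2[OF summable_geometric_powr], where N = 0])
       auto
qed

lemma dyadic_sum_split_head: "x \<ge> 1 \<Longrightarrow> dyadic_sum x = h x + dyadic_sum (2 * x)"
  using suminf_split_head[OF summable_dyadic[of x]] by (simp add: dyadic_sum_def mult_ac)

lemma continuous_on_dyadic_sum: "continuous_on {1..} dyadic_sum"
proof -
  obtain C where C: "C \<ge> 0"
    "\<And>x j. x \<ge> 1 \<Longrightarrow> \<bar>h (2 ^ j * x)\<bar> \<le> C * (2 powr -\<sigma>) ^ j * x powr -\<sigma>"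
    using dyadic_term_bound by blast
  have "uniform_limit {1..} (\<lambda>n x. \<Sum>j<n. h (2 ^ j * x)) dyadic_sum sequentially"
    unfolding dyadic_sum_def
  proof (rule Weierstrass_m_test[OF _ summable_geometric_powr])
    fix j and x :: real assume "x \<in> {1..}"
    hence "\<bar>h (2 ^ j * x)\<bar> \<le> C * (2 powr -\<sigma>) ^ j * x powr -\<sigma>" and "x powr -\<sigma> \<le> 1"
      using C(2) powr_mono[of "-\<sigma>" 0 x] decay_pos by auto
    thus "norm (h (2 ^ j * x)) \<le> C * (2 powr -\<sigma>) ^ j"
      using mult_left_mono[of "x powr -\<sigma>" 1 "C * (2 powr -\<sigma>) ^ j"] C(1) by simp
  qed
  moreover have "continuous_on {1..} (\<lambda>x. \<Sum>j<n. h (2 ^ j * x))" for n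
  proof (intro continuous_on_sum continuous_on_compose2[OF continuous])
    show "(*) (2 ^ j) ` {1..} \<subseteq> {1 :: real..}" for j :: nat
      by (auto intro: one_le_two_power_mult)
  qed (intro continuous_intros)
  ultimately show ?thesis
    by (intro uniform_limit_theorem[rotated]) auto
qed

lemma dyadic_sum_bigo: "dyadic_sum \<in> O(\<lambda>x. x powr -\<sigma>)"
proof -
  obtain C where C: "C \<ge> 0"
    "\<And>x j. x \<ge> 1 \<Longrightarrow> \<bar>h (2 ^ j * x)\<bar> \<le> C * (2 powr -\<sigma>) ^ j * x powr -\<sigma>"
    using dyadic_term_bound by blast
  have "\<bar>dyadic_sum x\<bar> \<le> (\<Sum>j. C * (2 powr -\<sigma>) ^ j) * x powr -\<sigma>" if "x \<ge> 1" for x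
  proof -
    have "norm (dyadic_sum x) \<le> (\<Sum>j. C * (2 powr -\<sigma>) ^ j * x powr -\<sigma>)"
      unfolding dyadic_sum_def
      by (rule norm_suminf_le) (use C that in \<open>auto intro: summable_mult2 summable_geometric_powr\<close>)
    thus ?thesis
      by (simp add: suminf_mult2[OF summable_geometric_powr])
  qed
  thus ?thesis
    by (intro bigoI eventually_mono[OF eventually_ge_at_top[of 1]]) auto
qed

sublocale dyadic_sum: powr_bigo dyadic_sum \<sigma>
  by unfold_locales (rule continuous_on_dyadic_sum dyadic_sum_bigo)+

lemma dyadic_sum_tendsto_0: "(dyadic_sum \<longlongrightarrow> 0) at_top"
proof -
  have "((\<lambda>x. x powr -\<sigma>) \<longlongrightarrow> (0::real)) at_top"
    using decay_pos by (intro tendsto_neg_powr filterlim_ident) auto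
  hence "(\<lambda>x. x powr -\<sigma>) \<in> o(\<lambda>_. 1 :: real)"
    by (intro smalloI_tendsto) auto
  thus ?thesis
    using landau_o.big_small_trans[OF dyadic_sum_bigo] smalloD_tendsto by fastforce
qed

lemma mellin_integrand_dyadic_sum:
  assumes "x \<ge> 1"
  shows "mellin_integrand h s x
    = mellin_integrand dyadic_sum s x - 2 powr (1 - s) * mellin_integrand dyadic_sum s (2 * x)"
proof -
  have "complex_of_real (2 * x) powr (s - 1) = 2 powr (s - 1) * of_real x powr (s - 1)"
    using assms by (simp add: powr_times_real)
  hence "2 powr (1 - s) * mellin_integrand dyadic_sum s (2 * x)
      = (2 powr (1 - s) * 2 powr (s - 1)) * (of_real (dyadic_sum (2 * x)) * of_real x powr (s - 1))"
    unfolding mellin_integrand_def by (simp only: mult_ac)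
  also have "2 powr (1 - s) * 2 powr (s - 1) = (1 :: complex)"
    by (simp flip: powr_add)
  finally have "2 powr (1 - s) * mellin_integrand dyadic_sum s (2 * x)
      = of_real (dyadic_sum (2 * x)) * of_real x powr (s - 1)"
    by (simp only: mult_1)
  thus ?thesis
    unfolding mellin_integrand_def[of dyadic_sum s x] mellin_integrand_def[of h]
      dyadic_sum_split_head[OF assms]
    by (simp only: of_real_add distrib_right add_diff_cancel_right')
qed

lemma truncated_mellin_dyadic_sum:
  assumes N: "N \<ge> 1"
  shows "integral {1..N} (mellin_integrand h s) = integral {1..N} (mellin_integrand dyadic_sum s)
    - 2 powr - s * (integral {1..2 * N} (mellin_integrand dyadic_sum s)
                    - integral {1..2} (mellin_integrand dyadic_sum s))"
proof -
  define F where "F = mellin_integrand dyadic_sum s"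
  have integrable: "F integrable_on {a..b}" if "a \<ge> 1" for a b
    unfolding F_def using that
    by (intro integrable_continuous_interval
        continuous_on_subset[OF dyadic_sum.continuous_on_mellin_integrand_half_line]) auto
  have "integral {1..2} F + integral {2..2 * N} F = integral {1..2 * N} F"
    using N by (intro Henstock_Kurzweil_Integration.integral_combine integrable) auto
  hence tail: "integral {2..2 * N} F = integral {1..2 * N} F - integral {1..2} F"
    by (simp add: algebra_simps)
  have "((\<lambda>x. F (2 * x)) has_integral (1 / \<bar>2\<bar>) *\<^sub>R integral {2..2 * N} F) ((\<lambda>x. x / 2) ` {2..2 * N})"
    by (intro has_integral_stretch_real integrable_integral integrable) auto
  also have "(\<lambda>x. x / 2) ` {2..2 * N} = {1..N}"
    using N by simp
  finally have "((\<lambda>x. F x - 2 powr (1 - s) * F (2 * x)) has_integral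
      integral {1..N} F - 2 powr (1 - s) * ((1 / \<bar>2\<bar>) *\<^sub>R integral {2..2 * N} F)) {1..N}"
    by (intro has_integral_diff has_integral_mult_right integrable_integral integrable) auto
  hence "(mellin_integrand h s has_integral
      integral {1..N} F - 2 powr (1 - s) * ((1 / \<bar>2\<bar>) *\<^sub>R integral {2..2 * N} F)) {1..N}"
    by (rule has_integral_eq[rotated]) (simp add: F_def mellin_integrand_dyadic_sum)
  moreover have "2 powr (1 - s) * ((1 / \<bar>2 :: real\<bar>) *\<^sub>R z) = 2 powr - s * z" for z :: complex
    using powr_add[of 2 1 "- s"] by (simp add: scaleR_conv_of_real)
  ultimately show ?thesis
    unfolding F_def[symmetric] tail by (simp add: integral_unique)
qed

lemma mellin_conv_dyadic_sum:
  assumes s: "Re s < \<sigma>"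
  shows "mellin h s = (1 - 2 powr - s) * mellin dyadic_sum s
    + 2 powr - s * integral {1..2} (mellin_integrand dyadic_sum s)"
proof -
  define I where "I = (\<lambda>N. integral {1..N} (mellin_integrand dyadic_sum s))"
  have I: "(I \<longlongrightarrow> mellin dyadic_sum s) at_top"
    unfolding I_def by (rule dyadic_sum.tendsto_truncated_mellin[OF s])
  moreover have "((\<lambda>N. I (2 * N)) \<longlongrightarrow> mellin dyadic_sum s) at_top"
    by (intro filterlim_compose[OF I] filterlim_tendsto_pos_mult_at_top[OF tendsto_const]
        filterlim_ident) simp
  ultimately have "((\<lambda>N. I N - 2 powr - s * (I (2 * N) - I 2)) \<longlongrightarrow>
      mellin dyadic_sum s - 2 powr - s * (mellin dyadic_sum s - I 2)) at_top"
    by (intro tendsto_intros)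
  moreover have "\<forall>\<^sub>F N in at_top.
      I N - 2 powr - s * (I (2 * N) - I 2) = integral {1..N} (mellin_integrand h s)"
    using eventually_ge_at_top[of 1]
    by eventually_elim (simp add: truncated_mellin_dyadic_sum I_def)
  ultimately have "((\<lambda>N. integral {1..N} (mellin_integrand h s)) \<longlongrightarrow>
      mellin dyadic_sum s - 2 powr - s * (mellin dyadic_sum s - I 2)) at_top"
    by (rule Lim_transform_eventually)
  from tendsto_unique[OF trivial_limit_at_top_linorder tendsto_truncated_mellin[OF s] this]
  show ?thesis
    by (simp add: I_def algebra_simps)
qed

end

section \<open>Fourier coefficients of functions of the binary logarithm\<close>

definition fourier_character :: "int \<Rightarrow> real \<Rightarrow> complex" where
  "fourier_character k t = exp (- 2 * of_int k * of_real pi * \<i> * of_real t)"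

lemma fourier_coeff_conv_character:
  "fourier_coeff P k = integral {0..1} (\<lambda>t. of_real (P t) * fourier_character k t)"
  by (simp add: fourier_coeff_def fourier_character_def)

lemma powr_chi: "complex_of_real (2 powr t) powr (- chi k) = fourier_character k t"
proof -
  have "complex_of_real (2 powr t) powr (- chi k) = exp (- chi k * of_real (t * ln 2))"
    by (simp add: powr_def Ln_of_real ln_powr)
  also have "- chi k * of_real (t * ln 2) = - 2 * of_int k * of_real pi * \<i> * of_real t"
    by (simp add: chi_def field_simps)
  finally show ?thesis
    by (simp add: fourier_character_def)
qed

lemma fourier_character_1: "fourier_character k 1 = 1"
  using exp_integer_2pi[of "of_int k"] by (simp add: fourier_character_def exp_minus mult_ac)

lemma Re_chi: "Re (chi k) = 0"
  by (simp add: chi_def)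

lemma two_powr_chi: "2 powr chi k = 1"
  using powr_chi[of 1 "- k"] by (simp add: fourier_character_1 chi_def)

lemma has_integral_fourier_powr_two:
  assumes "continuous_on {1..2} h"
  shows "((\<lambda>t. of_real (h (2 powr t)) * fourier_character k t) has_integral
    integral {1..2} (mellin_integrand h (- chi k)) / of_real (ln 2)) {0..1}"
proof -
  have "((\<lambda>t. (ln 2 * 2 powr t) *\<^sub>R mellin_integrand h (- chi k) (2 powr t)) has_integral
      integral {2 powr 0..2 powr 1} (mellin_integrand h (- chi k))) {0..1}"
  proof (rule has_integral_substitution[where c = 1 and d = 2])
    show "(powr) 2 ` {0..1} \<subseteq> {1..2 :: real}"
      using powr_mono[of 0 _ "2 :: real"] powr_mono[of _ 1 "2 :: real"] by auto
    show "continuous_on {1..2} (mellin_integrand h (- chi k))"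
      using assms by (rule continuous_on_mellin_integrand) auto
    show "((powr) 2 has_real_derivative ln 2 * 2 powr t) (at t within {0..1})" for t
      unfolding powr_def by (auto intro!: derivative_eq_intros)
  qed auto
  from has_integral_divide[OF this, of "of_real (ln 2)"]
  have "((\<lambda>t. (ln 2 * 2 powr t) *\<^sub>R mellin_integrand h (- chi k) (2 powr t) / of_real (ln 2)) has_integral
      integral {1..2} (mellin_integrand h (- chi k)) / of_real (ln 2)) {0..1}"
    by simp
  moreover have "(ln 2 * 2 powr t) *\<^sub>R mellin_integrand h (- chi k) (2 powr t) / of_real (ln 2)
      = of_real (h (2 powr t)) * fourier_character k t" for t
  proof -
    have "of_real (2 powr t) * of_real (2 powr t) powr (- chi k - 1) = fourier_character k t"
      using powr_chi[of t k] by (simp add: powr_diff)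
    thus ?thesis
      by (simp add: mellin_integrand_def scaleR_conv_of_real)
  qed
  ultimately show ?thesis
    by simp
qed

lemma has_integral_sawtooth:
  "((\<lambda>t. of_real (1 - t) * fourier_character k t) has_integral
    (if k = 0 then 1 / 2 else 1 / (of_real (ln 2) * chi k))) {0..1}"
proof (cases "k = 0")
  case True
  have "((\<lambda>t::real. 1 - t) has_integral (1 - 1\<^sup>2 / 2) - (0 - 0\<^sup>2 / 2)) {0..1}"
    by (rule fundamental_theorem_of_calculus)
       (auto intro!: derivative_eq_intros simp flip: has_real_derivative_iff_has_vector_derivative)
  from has_integral_of_real[OF this, where 'b = complex] show ?thesis
    using True by (simp add: fourier_character_def)
next
  case False
  define c where "c = 2 * of_int k * of_real pi * \<i>"
  have c_nonzero: "c \<noteq> 0" using False by (simp add: c_def)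
  have character: "fourier_character k t = exp (- c * of_real t)" for t
    by (simp add: fourier_character_def c_def)
  define F where "F = (\<lambda>z. exp (- c * z) * (1 / c ^ 2 - (1 - z) / c))"
  have "((\<lambda>t. (1 - of_real t) * exp (- c * of_real t)) has_integral
      F (of_real 1) - F (of_real 0)) {0..1}"
  proof (rule fundamental_theorem_of_calculus)
    fix t :: real
    have "(F has_field_derivative (1 - of_real t) * exp (- c * of_real t)) (at (of_real t))"
      unfolding F_def using c_nonzero
      by (auto intro!: derivative_eq_intros simp: field_simps power2_eq_square)
    from has_vector_derivative_real_field[OF this]
    show "((\<lambda>t. F (of_real t)) has_vector_derivative (1 - of_real t) * exp (- c * of_real t))
        (at t within {0..1})" .
  qed auto
  moreover have "exp (- c) = 1"
    using fourier_character_1[of k] character[of 1] by simp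
  hence "F (of_real 1) - F (of_real 0) = 1 / c"
    using c_nonzero by (simp add: F_def field_simps)
  moreover have "of_real (ln 2) * chi k = c"
    by (simp add: chi_def c_def)
  ultimately show ?thesis
    using False by (simp add: character)
qed

section \<open>Dyadic recurrences\<close>

locale dyadic_recurrence = powr_decaying +
  fixes u :: "real \<Rightarrow> real"
  assumes continuous_solution: "continuous_on {1..} u"
    and recurrence: "x \<ge> 1 \<Longrightarrow> u (2 * x) = u x + 1 + h (2 * x)"
begin

definition doubling_invariant :: "real \<Rightarrow> real" where
  "doubling_invariant x = u x + dyadic_sum (2 * x) - log 2 x"

definition periodic_part :: "real \<Rightarrow> real" where
  "periodic_part t = doubling_invariant (2 powr frac t)"

lemma doubling_invariant_two_power_mult:
  assumes "x \<ge> 1"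
  shows "doubling_invariant (2 ^ n * x) = doubling_invariant x"
proof (induction n)
  case (Suc n)
  define y where "y = 2 ^ n * x"
  have y: "y \<ge> 1"
    unfolding y_def by (rule one_le_two_power_mult) fact
  have "doubling_invariant (2 * y) = doubling_invariant y"
    using recurrence[OF y] dyadic_sum_split_head[of "2 * y"] y
    by (simp add: doubling_invariant_def log_mult)
  with Suc show ?case
    by (simp add: y_def mult.assoc)
qed simp

lemma periodic_part_plus_1: "periodic_part (t + 1) = periodic_part t"
  by (simp add: periodic_part_def frac_def)

theorem dyadic_expansion:
  assumes "x \<ge> 1"
  shows "u x = log 2 x + periodic_part (log 2 x) - dyadic_sum (2 * x)"
proof -
  define n where "n = nat \<lfloor>log 2 x\<rfloor>"
  define y where "y = 2 powr frac (log 2 x)"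
  have n: "log 2 x = real n + frac (log 2 x)"
    using assms by (simp add: n_def frac_def)
  have "x = 2 powr log 2 x"
    using assms by simp
  also have "\<dots> = 2 ^ n * y"
    by (subst n) (simp add: powr_add powr_realpow y_def)
  finally have x: "x = 2 ^ n * y" .
  have "y \<ge> 1"
    by (simp add: y_def ge_one_powr_ge_zero)
  from doubling_invariant_two_power_mult[OF this, of n] show ?thesis
    unfolding x[symmetric] by (simp add: periodic_part_def doubling_invariant_def y_def)
qed

lemma periodic_part_eq:
  assumes "t \<in> {0..1}"
  shows "periodic_part t = (u (2 powr t) - h (2 powr t) - 1) + dyadic_sum (2 powr t) + (1 - t)"
proof -
  have "2 powr t \<ge> (1 :: real)"
    using assms by (simp add: ge_one_powr_ge_zero)
  from dyadic_expansion[OF this] dyadic_sum_split_head[OF this] show ?thesis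
    by simp
qed

lemma continuous_on_doubling_invariant: "continuous_on {1..} doubling_invariant"
  unfolding doubling_invariant_def
  by (intro continuous_intros continuous_solution
      continuous_on_compose2[OF continuous_on_dyadic_sum]) auto

lemma continuous_on_periodic_part: "continuous_on UNIV periodic_part"
  unfolding periodic_part_def
proof (rule continuous_on_frac_compose)
  show "continuous_on {0..1} (\<lambda>t. doubling_invariant (2 powr t))"
    by (intro continuous_on_compose2[OF continuous_on_doubling_invariant] continuous_intros)
       (auto simp: ge_one_powr_ge_zero)
  show "doubling_invariant (2 powr 0) = doubling_invariant (2 powr 1)"
    using doubling_invariant_two_power_mult[of 1 1] by simp
qed

theorem fourier_coeff_periodic_part:
  "fourier_coeff periodic_part k =
     integral {1..2} (mellin_integrand (\<lambda>x. u x - h x - 1) (- chi k)) / of_real (ln 2) +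
     mellin h (- chi k) / of_real (ln 2) +
     (if k = 0 then 1 / 2 else 1 / (of_real (ln 2) * chi k))"
    (is "_ = ?coeff")
proof -
  have half_line: "{1..2} \<subseteq> {1 :: real..}" by auto
  have "mellin h (- chi k) = integral {1..2} (mellin_integrand dyadic_sum (- chi k))"
    using mellin_conv_dyadic_sum[of "- chi k"] decay_pos by (simp add: two_powr_chi Re_chi)
  hence sum: "((\<lambda>t. of_real (dyadic_sum (2 powr t)) * fourier_character k t) has_integral
      mellin h (- chi k) / of_real (ln 2)) {0..1}"
    using has_integral_fourier_powr_two[OF continuous_on_subset[OF continuous_on_dyadic_sum half_line]]
    by simp
  have "continuous_on {1..2} (\<lambda>x. u x - h x - 1)"
    by (intro continuous_intros continuous_on_subset[OF continuous half_line]
        continuous_on_subset[OF continuous_solution half_line])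
  note initial = has_integral_fourier_powr_two[OF this, of k]
  from has_integral_add[OF has_integral_add[OF initial sum] has_integral_sawtooth[of k]]
  have "((\<lambda>t. of_real (periodic_part t) * fourier_character k t) has_integral ?coeff) {0..1}"
    by (rule has_integral_eq[rotated]) (simp only: periodic_part_eq of_real_add distrib_right)
  thus ?thesis
    unfolding fourier_coeff_conv_character by (rule integral_unique)
qed

lemma mellin_extension_at_chi:
  "mellin h (- chi k) / of_real (ln 2) + (if k = 0 then 1 / 2 else 1 / (of_real (ln 2) * chi k)) =
     (if k \<noteq> 0 then 1 / of_real (ln 2) * mellin_extension a (- of_real a - chi k)
      else 1 / of_real (ln 2) * finite_value (mellin_extension a) (- of_real a) + 1 / 2)"
proof (cases "k = 0")
  case True
  thus ?thesis
    by (simp add: finite_value_mellin_extension chi_def)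
next
  case False
  thus ?thesis
    by (simp add: mellin_extension_def chi_def field_simps)
qed

end

section \<open>Interpolation of sequences\<close>

lemma interpolate_of_nat:
  assumes "\<phi> 0 = 0" and "n \<ge> 1"
  shows "interpolate \<phi> g (real n) = g n"
  using assms by (simp add: interpolate_def frac_def)

lemma interpolate_add:
  assumes "\<phi> 0 = 0" and "\<phi> 1 = 1" and "n \<ge> 1" and "t \<in> {0..1}"
  shows "interpolate \<phi> g (real n + t) = (1 - \<phi> t) * g n + \<phi> t * g (n + 1)"
proof (cases "t = 1")
  case True
  have "real n + t = real (n + 1)" using True by simp
  thus ?thesis
    using True assms interpolate_of_nat[of \<phi> "n + 1" g] by (simp add: add.commute)
next
  case False
  hence "\<lfloor>real n + t\<rfloor> = int n"
    using assms by (auto simp: floor_eq_iff)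
  thus ?thesis
    using assms by (simp add: interpolate_def frac_def)
qed

lemma continuous_on_interpolate:
  assumes cont: "continuous_on {0..1} \<phi>" and \<phi>: "\<phi> 0 = 0" "\<phi> 1 = 1"
  shows "continuous_on {1..} (interpolate \<phi> g)"
proof (rule continuous_on_unit_intervals)
  fix n :: int
  consider (inside) "n \<ge> 1" | (outside) "{1..} \<inter> {of_int n..of_int n + 1 :: real} \<subseteq> {1}"
    by force
  thus "continuous_on ({1..} \<inter> {of_int n..of_int n + 1}) (interpolate \<phi> g)"
  proof cases
    case inside
    define m where "m = nat n"
    have n: "of_int n = real m" and m: "m \<ge> 1"
      using inside by (auto simp: m_def)
    have "continuous_on {real m..real m + 1} (\<lambda>x. \<phi> (x - real m))"
      by (rule continuous_on_compose2[OF cont]) (auto intro!: continuous_intros)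
    hence "continuous_on {real m..real m + 1}
        (\<lambda>x. (1 - \<phi> (x - real m)) * g m + \<phi> (x - real m) * g (m + 1))"
      by (intro continuous_intros)
    moreover have "(1 - \<phi> (x - real m)) * g m + \<phi> (x - real m) * g (m + 1) = interpolate \<phi> g x"
      if "x \<in> {real m..real m + 1}" for x
      using interpolate_add[OF \<phi> m, of "x - real m" g] that by simp
    ultimately have "continuous_on {real m..real m + 1} (interpolate \<phi> g)"
      by (rule continuous_on_eq)
    thus ?thesis
      unfolding n by (rule continuous_on_subset) simp
  next
    case outside
    thus ?thesis
      by (rule continuous_on_subset[OF continuous_on_sing])
  qed
qed simp

section \<open>Interpolation of sequences close to a power\<close>

lemma asymp_equiv_of_bounded_diff:
  fixes y :: "real \<Rightarrow> real"
  assumes "(\<lambda>x. y x - x) \<in> O(\<lambda>_. 1)"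
  shows "y \<sim>[at_top] (\<lambda>x. x)"
proof (rule smallo_imp_asymp_equiv)
  have "(\<lambda>_. 1) \<in> o(\<lambda>x :: real. x)"
    by (intro smalloI_tendsto tendsto_divide_0[OF tendsto_const] filterlim_at_top_imp_at_infinity
        filterlim_ident eventually_mono[OF eventually_gt_at_top[of 0]]) simp
  with assms show "(\<lambda>x. y x - x) \<in> o(\<lambda>x. x)"
    by (rule landau_o.big_small_trans)
qed

lemma powr_diff_bigo:
  fixes y :: "real \<Rightarrow> real"
  assumes bounded_diff: "(\<lambda>x. y x - x) \<in> O(\<lambda>_. 1)"
  shows "(\<lambda>x. y x powr a - x powr a) \<in> O(\<lambda>x. x powr (a - 1))"
proof -
  have "((\<lambda>z. z powr a) has_real_derivative a) (at 1)"
    by (auto intro!: derivative_eq_intros)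
  then obtain q where q: "\<And>z. z powr a - 1 = q z * (z - 1)" and "isCont q 1"
    unfolding CARAT_DERIV by auto
  have ratio: "((\<lambda>x. y x / x) \<longlongrightarrow> 1) at_top"
    by (intro asymp_equivD_strong asymp_equiv_of_bounded_diff bounded_diff
        eventually_mono[OF eventually_gt_at_top[of 0]]) auto
  have "((\<lambda>x. q (y x / x) / 1) \<longlongrightarrow> q 1) at_top"
    using isCont_tendsto_compose[OF \<open>isCont q 1\<close> ratio] by simp
  hence "(\<lambda>x. q (y x / x)) \<in> O(\<lambda>_. 1)"
    by (rule bigoI_tendsto) simp
  hence "(\<lambda>x. x powr (a - 1) * (q (y x / x) * (y x - x))) \<in> O(\<lambda>x. x powr (a - 1) * 1)"
    by (intro landau_o.big.mult_left landau_o.big.mult_in_1 bounded_diff)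
  moreover have "\<forall>\<^sub>F x in at_top.
      y x powr a - x powr a = x powr (a - 1) * (q (y x / x) * (y x - x))"
    using eventually_gt_at_top[of 0]
  proof eventually_elim
    case (elim x)
    have "y x powr a - x powr a = x powr a * ((y x / x) powr a - 1)"
      using elim by (simp add: powr_divide right_diff_distrib)
    also have "\<dots> = x powr a * (q (y x / x) * ((y x - x) / x))"
      using elim by (simp add: q diff_divide_distrib)
    also have "\<dots> = x powr (a - 1) * (q (y x / x) * (y x - x))"
      using elim by (simp add: powr_diff)
    finally show ?case .
  qed
  ultimately show ?thesis
    by (simp add: landau_o.big.in_cong)
qed

lemma powr_bigo_of_bounded_diff:
  fixes y :: "real \<Rightarrow> real"
  assumes "(\<lambda>x. y x - x) \<in> O(\<lambda>_. 1)"
  shows "(\<lambda>x. y x powr a) \<in> O(\<lambda>x. x powr a)"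
proof -
  have "(\<lambda>x :: real. x powr (a - 1)) \<in> O(\<lambda>x. x powr a)"
    by (simp add: powr_bigo_iff filterlim_ident)
  with powr_diff_bigo[OF assms] have "(\<lambda>x. y x powr a - x powr a) \<in> O(\<lambda>x. x powr a)"
    by (rule landau_o.big_trans)
  from sum_in_bigo(1)[OF this landau_o.big_refl] show ?thesis
    by simp
qed

lemma sequence_near_powr_compose:
  fixes g :: "nat \<Rightarrow> real" and m :: "real \<Rightarrow> nat"
  assumes near_powr: "(\<lambda>n. g n - real n powr a) \<in> O(\<lambda>n. real n powr b)" and "a - 1 \<le> b"
    and bounded_diff: "(\<lambda>x. real (m x) - x) \<in> O(\<lambda>_. 1)"
  shows "(\<lambda>x. g (m x) - x powr a) \<in> O(\<lambda>x. x powr b)"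
proof -
  have "filterlim (\<lambda>x. real (m x)) at_top at_top"
    using asymp_equiv_of_bounded_diff[OF bounded_diff]
    by (intro asymp_equiv_at_top_transfer[OF asymp_equiv_symI filterlim_ident])
  hence "filterlim m sequentially at_top"
    by (simp add: filterlim_sequentially_iff_filterlim_real)
  from landau_o.big.compose[OF near_powr this] powr_bigo_of_bounded_diff[OF bounded_diff]
  have "(\<lambda>x. g (m x) - real (m x) powr a) \<in> O(\<lambda>x. x powr b)"
    by (rule landau_o.big_trans)
  moreover have "(\<lambda>x :: real. x powr (a - 1)) \<in> O(\<lambda>x. x powr b)"
    using \<open>a - 1 \<le> b\<close> by (simp add: powr_bigo_iff filterlim_ident)
  with powr_diff_bigo[OF bounded_diff] have "(\<lambda>x. real (m x) powr a - x powr a) \<in> O(\<lambda>x. x powr b)"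
    by (rule landau_o.big_trans)
  ultimately show ?thesis
    using sum_in_bigo(1) by fastforce
qed

lemma interpolate_near_powr:
  assumes cont: "continuous_on {0..1} \<phi>"
    and near_powr: "(\<lambda>n. g n - real n powr a) \<in> O(\<lambda>n. real n powr b)" "a - 1 \<le> b"
  shows "(\<lambda>x. interpolate \<phi> g x - x powr a) \<in> O(\<lambda>x. x powr b)"
proof -
  define m where "m = (\<lambda>x :: real. nat \<lfloor>x\<rfloor>)"
  have "\<bar>real (m x) - x\<bar> \<le> 1" "\<bar>real (m x + 1) - x\<bar> \<le> 1" if "x \<ge> 1" for x
    using that unfolding m_def by linarith+
  hence "(\<lambda>x. real (m x) - x) \<in> O(\<lambda>_. 1)" "(\<lambda>x. real (m x + 1) - x) \<in> O(\<lambda>_. 1)"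
    by (intro bigoI[where c = 1] eventually_mono[OF eventually_ge_at_top[of 1]], simp)+
  note floor = sequence_near_powr_compose[OF near_powr this(1)]
    and ceiling = sequence_near_powr_compose[OF near_powr this(2)]
  have "bounded (\<phi> ` {0..1})"
    by (intro compact_imp_bounded compact_continuous_image cont) auto
  then obtain B where B: "\<forall>t\<in>{0..1}. \<bar>\<phi> t\<bar> \<le> B"
    by (auto simp: bounded_iff)
  have "\<bar>\<phi> (frac x)\<bar> \<le> B" for x :: real
    using B by (simp add: less_imp_le frac_lt_1)
  hence \<phi>_bigo: "(\<lambda>x :: real. \<phi> (frac x)) \<in> O(\<lambda>_. 1)"
    by (intro bigoI[where c = B]) simp
  hence "(\<lambda>x :: real. 1 - \<phi> (frac x)) \<in> O(\<lambda>_. 1)"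
    by (intro sum_in_bigo) auto
  from sum_in_bigo(1)[OF landau_o.big.mult[OF this floor] landau_o.big.mult[OF \<phi>_bigo ceiling]]
  have "(\<lambda>x. (1 - \<phi> (frac x)) * (g (m x) - x powr a) + \<phi> (frac x) * (g (m x + 1) - x powr a))
      \<in> O(\<lambda>x. x powr b)"
    by simp
  moreover have "\<forall>\<^sub>F x in at_top. interpolate \<phi> g x - x powr a
      = (1 - \<phi> (frac x)) * (g (m x) - x powr a) + \<phi> (frac x) * (g (m x + 1) - x powr a)"
    using eventually_ge_at_top[of 1]
    by eventually_elim (simp add: interpolate_def m_def algebra_simps)
  ultimately show ?thesis
    by (simp add: landau_o.big.in_cong)
qed

section \<open>Divide-and-conquer recurrences\<close>

locale divide_and_conquer =
  fixes \<alpha> \<beta> :: real and \<phi> :: "real \<Rightarrow> real" and f g :: "nat \<Rightarrow> real"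
  assumes \<alpha>_pos: "\<alpha> > 0" and \<beta>_pos: "\<beta> > 0"
    and interpolation_fun: "interpolation_fun \<alpha> \<beta> \<phi>"
    and halving: "n \<ge> 2 \<Longrightarrow>
      f n = \<alpha> * f (nat \<lfloor>real n / 2\<rfloor>) + \<beta> * f (nat \<lceil>real n / 2\<rceil>) + g n"
    and g_1: "g 1 = 0"
begin

lemma continuous_on_\<phi>: "continuous_on {0..1} \<phi>"
  and \<phi>_0: "\<phi> 0 = 0" and \<phi>_1: "\<phi> 1 = 1"
  using interpolation_fun by (auto simp: interpolation_fun_def)

lemma \<phi>_left_half:
  assumes "t \<in> {0..1/2}"
  shows "(\<alpha> + \<beta>) * \<phi> t = \<beta> * \<phi> (2 * t)"
proof -
  have "\<phi> t = \<beta> / (\<alpha> + \<beta>) * \<phi> (2 * t)"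
    using interpolation_fun assms unfolding interpolation_fun_def by blast
  thus ?thesis
    using \<alpha>_pos \<beta>_pos by simp
qed

lemma \<phi>_right_half:
  assumes "t \<in> {1/2..1}"
  shows "(\<alpha> + \<beta>) * \<phi> t = \<alpha> * \<phi> (2 * t - 1) + \<beta>"
proof -
  have "\<phi> t = \<alpha> / (\<alpha> + \<beta>) * \<phi> (2 * t - 1) + \<beta> / (\<alpha> + \<beta>)"
    using interpolation_fun assms unfolding interpolation_fun_def by blast
  thus ?thesis
    using \<alpha>_pos \<beta>_pos by (simp add: distrib_left)
qed

lemma halving_even: "m \<ge> 1 \<Longrightarrow> f (2 * m) = (\<alpha> + \<beta>) * f m + g (2 * m)"
  using halving[of "2 * m"] by (simp add: algebra_simps)

lemma halving_odd:
  assumes "m \<ge> 1"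
  shows "f (2 * m + 1) = \<alpha> * f m + \<beta> * f (m + 1) + g (2 * m + 1)"
proof -
  have "\<lfloor>real (2 * m + 1) / 2\<rfloor> = int m" "\<lceil>real (2 * m + 1) / 2\<rceil> = int (m + 1)"
    by (auto simp: floor_eq_iff ceiling_eq_iff)
  hence "nat \<lfloor>real (2 * m + 1) / 2\<rfloor> = m" "nat \<lceil>real (2 * m + 1) / 2\<rceil> = m + 1"
    by (simp_all only: nat_int)
  thus ?thesis
    using halving[of "2 * m + 1"] assms by (simp only:)
qed

lemma continuous_on_interpolated: "continuous_on {1..} (interpolate \<phi> h)"
  by (intro continuous_on_interpolate continuous_on_\<phi> \<phi>_0 \<phi>_1)

lemma interpolated_add:
  "n \<ge> 1 \<Longrightarrow> t \<in> {0..1} \<Longrightarrow> interpolate \<phi> h (real n + t) = (1 - \<phi> t) * h n + \<phi> t * h (n + 1)"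
  by (intro interpolate_add \<phi>_0 \<phi>_1)

lemma interpolated_doubling:
  assumes "y \<ge> 1"
  shows "interpolate \<phi> f (2 * y) = (\<alpha> + \<beta>) * interpolate \<phi> f y + interpolate \<phi> g (2 * y)"
proof -
  define m t where "m = nat \<lfloor>y\<rfloor>" and "t = frac y"
  have m: "m \<ge> 1" and t: "t \<in> {0..1}" and y: "y = real m + t"
    using assms frac_lt_1[of y] by (auto simp: m_def t_def frac_def le_nat_iff le_floor_iff)
  have half: "(\<alpha> + \<beta>) * interpolate \<phi> f y
      = (\<alpha> + \<beta>) * f m + (\<alpha> + \<beta>) * \<phi> t * (f (m + 1) - f m)"
    unfolding y interpolated_add[OF m t] by (simp add: algebra_simps)
  consider (left) "t \<in> {0..1/2}" | (right) "t \<in> {1/2..1}"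
    using t by fastforce
  thus ?thesis
  proof cases
    case left
    have y: "2 * y = real (2 * m) + 2 * t"
      by (simp add: y)
    have between: "interpolate \<phi> h (2 * y)
        = (1 - \<phi> (2 * t)) * h (2 * m) + \<phi> (2 * t) * h (2 * m + 1)" for h
      unfolding y using m left by (intro interpolated_add) auto
    show ?thesis
      unfolding half \<phi>_left_half[OF left] between halving_even[OF m] halving_odd[OF m] by algebra
  next
    case right
    have y: "2 * y = real (2 * m + 1) + (2 * t - 1)"
      by (simp add: y)
    have between: "interpolate \<phi> h (2 * y)
        = (1 - \<phi> (2 * t - 1)) * h (2 * m + 1) + \<phi> (2 * t - 1) * h (2 * (m + 1))" for h
      unfolding y using interpolated_add[of "2 * m + 1" "2 * t - 1"] right by simp
    have "f (2 * (m + 1)) = (\<alpha> + \<beta>) * f (m + 1) + g (2 * (m + 1))"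
      by (rule halving_even) simp
    thus ?thesis
      unfolding half \<phi>_right_half[OF right] between halving_odd[OF m] by algebra
  qed
qed

lemma interpolated_initial:
  assumes "x \<in> {1..2}"
  shows "interpolate \<phi> f x = f 1 * (1 + (\<alpha> + \<beta> - 1) * \<phi> (x - 1)) + interpolate \<phi> g x"
proof -
  have between: "interpolate \<phi> h x = (1 - \<phi> (x - 1)) * h 1 + \<phi> (x - 1) * h 2" for h
    using interpolated_add[of 1 "x - 1" h] assms by (simp add: numeral_2_eq_2)
  have "f 2 = (\<alpha> + \<beta>) * f 1 + g 2"
    using halving_even[of 1] by simp
  thus ?thesis
    unfolding between g_1 by algebra
qed

end

section \<open>The critical toll function\<close>

locale critical_divide_and_conquer = divide_and_conquer +
  fixes \<rho> \<delta> :: real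
  assumes two_powr_\<rho>: "2 powr \<rho> = \<alpha> + \<beta>"
    and \<delta>_pos: "\<delta> > 0" and \<delta>_le_1: "\<delta> \<le> 1"
    and toll: "(\<lambda>n. g n - real n powr \<rho>) \<in> O(\<lambda>n. real n powr (\<rho> - \<delta>))"
begin

definition normalized_solution :: "real \<Rightarrow> real" where
  "normalized_solution x = x powr -\<rho> * interpolate \<phi> f x"

definition deviation :: "real \<Rightarrow> real" where
  "deviation x = x powr -\<rho> * interpolate \<phi> g x - 1"

lemma interpolated_solution: "x \<ge> 1 \<Longrightarrow> interpolate \<phi> f x = x powr \<rho> * normalized_solution x"
  by (simp add: normalized_solution_def powr_minus)

lemma interpolated_toll: "x \<ge> 1 \<Longrightarrow> interpolate \<phi> g x = x powr \<rho> * (1 + deviation x)"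
  by (simp add: deviation_def powr_minus)

lemma deviation_bigo: "deviation \<in> O(\<lambda>x. x powr -\<delta>)"
proof -
  have "(\<lambda>x. interpolate \<phi> g x - x powr \<rho>) \<in> O(\<lambda>x. x powr (\<rho> - \<delta>))"
    using \<delta>_le_1 by (intro interpolate_near_powr continuous_on_\<phi> toll) simp
  hence "(\<lambda>x. x powr -\<rho> * (interpolate \<phi> g x - x powr \<rho>)) \<in> O(\<lambda>x. x powr -\<rho> * x powr (\<rho> - \<delta>))"
    by (rule landau_o.big.mult_left)
  moreover have "\<forall>\<^sub>F x in at_top. deviation x = x powr -\<rho> * (interpolate \<phi> g x - x powr \<rho>)"
    using eventually_gt_at_top[of 0]
    by eventually_elim (simp add: deviation_def right_diff_distrib flip: powr_add)
  ultimately show ?thesis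
    by (simp add: landau_o.big.in_cong flip: powr_add)
qed

lemma normalized_recurrence:
  assumes "x \<ge> 1"
  shows "normalized_solution (2 * x) = normalized_solution x + 1 + deviation (2 * x)"
proof -
  have "(2 * x) powr -\<rho> * (\<alpha> + \<beta>) = x powr -\<rho>"
    unfolding two_powr_\<rho>[symmetric] using assms by (simp add: powr_mult powr_minus)
  hence "(2 * x) powr -\<rho> * ((\<alpha> + \<beta>) * z) = x powr -\<rho> * z" for z
    by (simp add: mult.assoc[symmetric])
  thus ?thesis
    unfolding normalized_solution_def deviation_def interpolated_doubling[OF assms]
    by (simp only: distrib_left)
qed

sublocale dyadic_recurrence deviation \<delta> normalized_solution
proof unfold_locales
  show "continuous_on {1..} deviation"
    unfolding deviation_def by (intro continuous_intros continuous_on_interpolated) auto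
  show "continuous_on {1..} normalized_solution"
    unfolding normalized_solution_def by (intro continuous_intros continuous_on_interpolated) auto
qed (rule deviation_bigo \<delta>_pos normalized_recurrence; assumption?)+

definition remainder :: "nat \<Rightarrow> real" where
  "remainder n = real n powr \<rho> * dyadic_sum (2 * real n)"

lemma solution_expansion:
  assumes "n \<ge> 1"
  shows "f n = real n powr \<rho> * log 2 (real n) + real n powr \<rho> * periodic_part (log 2 (real n))
    - remainder n"
proof -
  have "f n = real n powr \<rho> * normalized_solution (real n)"
    using interpolated_solution[of "real n"] interpolate_of_nat[of \<phi>, OF \<phi>_0 assms] assms by simp
  thus ?thesis
    using dyadic_expansion[of "real n"] assms by (simp add: remainder_def algebra_simps)
qed

lemma remainder_smallo: "remainder \<in> o(\<lambda>n. real n powr \<rho>)"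
proof -
  have "filterlim (\<lambda>n. 2 * real n) at_top sequentially"
    by (intro filterlim_tendsto_pos_mult_at_top[OF tendsto_const] filterlim_real_sequentially) simp
  from filterlim_compose[OF dyadic_sum_tendsto_0 this]
  have "(\<lambda>n. dyadic_sum (2 * real n)) \<in> o(\<lambda>_. 1)"
    by (intro smalloI_tendsto) auto
  from landau_o.small.mult_left[OF this, of "\<lambda>n. real n powr \<rho>"] show ?thesis
    by (simp add: remainder_def[abs_def])
qed

lemma remainder_eq_0:
  assumes even: "\<forall>n\<ge>2. even n \<longrightarrow> g n = real n powr \<rho>" and n: "n \<ge> 1"
  shows "remainder n = 0"
proof -
  have "deviation (2 ^ j * (2 * real n)) = 0" for j
  proof -
    define m where "m = 2 ^ Suc j * n"
    have "n \<le> 2 ^ j * n" by simp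
    hence m: "m \<ge> 2" "even m"
      using n by (auto simp: m_def)
    have "deviation (real m) = 0"
      using interpolate_of_nat[of \<phi> m g] \<phi>_0 even m by (simp add: deviation_def flip: powr_add)
    thus ?thesis
      by (simp add: m_def mult_ac)
  qed
  thus ?thesis
    by (simp add: remainder_def dyadic_sum_def)
qed

lemma initial_mellin:
  "integral {1..2} (mellin_integrand (\<lambda>x. normalized_solution x - deviation x - 1) (- chi k))
    = of_real (f 1) * integral {0..1} (\<lambda>u. of_real (1 + (\<alpha> + \<beta> - 1) * \<phi> u) /
        of_real (1 + u) powr (of_real \<rho> + chi k + 1))"
proof -
  define w where "w = (\<lambda>x. f 1 * (1 + (\<alpha> + \<beta> - 1) * \<phi> (x - 1)))"
  have "mellin_integrand (\<lambda>x. normalized_solution x - deviation x - 1) (- chi k) x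
      = mellin_integrand w (- chi k - of_real \<rho>) x" if "x \<in> {1..2}" for x
  proof -
    have "normalized_solution x - deviation x - 1 = x powr -\<rho> * w x"
      unfolding normalized_solution_def deviation_def w_def interpolated_initial[OF that]
      by (simp add: distrib_left)
    thus ?thesis
      using mellin_integrand_powr_mult[of x "-\<rho>" w "- chi k"] that by (simp add: mellin_integrand_def)
  qed
  hence "integral {1..2} (mellin_integrand (\<lambda>x. normalized_solution x - deviation x - 1) (- chi k))
      = integral {1..2} (mellin_integrand w (- chi k - of_real \<rho>))"
    by (rule integral_cong)
  also have "\<dots> = integral {0..1} (\<lambda>u. mellin_integrand w (- chi k - of_real \<rho>) (u + 1))"
    using integral_shift_real_ivl[of 1 1 2 "mellin_integrand w (- chi k - of_real \<rho>)"] by simp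
  also have "\<dots> = integral {0..1} (\<lambda>u. of_real (f 1) * (of_real (1 + (\<alpha> + \<beta> - 1) * \<phi> u) /
      of_real (1 + u) powr (of_real \<rho> + chi k + 1)))"
  proof (rule integral_cong)
    fix u :: real
    have "- chi k - of_real \<rho> - 1 = - (of_real \<rho> + chi k + 1)"
      by simp
    hence "of_real (1 + u) powr (- chi k - of_real \<rho> - 1)
        = inverse (of_real (1 + u) powr (of_real \<rho> + chi k + 1))"
      by (simp only: powr_minus)
    thus "mellin_integrand w (- chi k - of_real \<rho>) (u + 1) = of_real (f 1) *
        (of_real (1 + (\<alpha> + \<beta> - 1) * \<phi> u) / of_real (1 + u) powr (of_real \<rho> + chi k + 1))"
      by (simp add: mellin_integrand_def w_def add.commute[of u 1] divide_inverse)
  qed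
  finally show ?thesis
    by (simp only: Henstock_Kurzweil_Integration.integral_mult_right)
qed

lemma fourier_coeff_expansion:
  "fourier_coeff periodic_part k = of_real (f 1) / of_real (ln 2) *
     integral {0..1} (\<lambda>u. of_real (1 + (\<alpha> + \<beta> - 1) * \<phi> u) /
                          of_real (1 + u) powr (of_real \<rho> + chi k + 1)) +
     (if k \<noteq> 0 then 1 / of_real (ln 2) * mellin_extension \<rho> (- of_real \<rho> - chi k)
      else 1 / of_real (ln 2) * finite_value (mellin_extension \<rho>) (- of_real \<rho>) + 1 / 2)"
  unfolding fourier_coeff_periodic_part mellin_extension_at_chi[of k \<rho>, symmetric] initial_mellin
  by simp

end

theorem theoremA2:
  fixes \<alpha> \<beta> \<rho> \<epsilon> :: real
    and f g g\<^sub>0 :: "nat \<Rightarrow> real"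
    and \<phi> :: "real \<Rightarrow> real"
  assumes "\<alpha> > 0" and "\<beta> > 0"
    and "\<rho> = log 2 (\<alpha> + \<beta>)"
    and "\<And>n. n \<ge> 2 \<Longrightarrow>
           f n = \<alpha> * f (nat \<lfloor>real n / 2\<rfloor>) + \<beta> * f (nat \<lceil>real n / 2\<rceil>) + g n"
    and "g 1 = 0"
    and "interpolation_fun \<alpha> \<beta> \<phi>"
    and "\<And>n. n \<ge> 2 \<Longrightarrow> g n = real n powr \<rho> + g\<^sub>0 n"
    and "\<epsilon> > 0"
    and "g\<^sub>0 \<in> O(\<lambda>n. real n powr (\<rho> - \<epsilon>))"
  shows "\<exists>(P :: real \<Rightarrow> real) (Q :: nat \<Rightarrow> real) (G :: complex \<Rightarrow> complex).
      continuous_on UNIV P \<and> (\<forall>t. P (t + 1) = P t) \<and>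
      Q \<in> o(\<lambda>n. real n powr \<rho>) \<and>
      (\<forall>n\<ge>1. f n = real n powr \<rho> * log 2 (real n) + real n powr \<rho> * P (log 2 (real n)) - Q n) \<and>
      (\<forall>s. Re s < - \<rho> \<longrightarrow>
         mellin_integrand (interpolate \<phi> g) s absolutely_integrable_on {1..} \<and>
         G s = mellin (interpolate \<phi> g) s) \<and>
      G meromorphic_on {s. Re s < - \<rho> + min \<epsilon> 1} \<and>
      G holomorphic_on {s. Re s < - \<rho> + min \<epsilon> 1} - {- of_real \<rho>} \<and>
      is_pole G (- of_real \<rho>) \<and> zorder G (- of_real \<rho>) = - 1 \<and>
      (\<forall>k. fourier_coeff P k =
         of_real (f 1) / of_real (ln 2) *
           integral {0..1} (\<lambda>u. of_real (1 + (\<alpha> + \<beta> - 1) * \<phi> u) /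
                                of_real (1 + u) powr (of_real \<rho> + chi k + 1)) +
         (if k \<noteq> 0 then 1 / of_real (ln 2) * G (- of_real \<rho> - chi k)
          else 1 / of_real (ln 2) * finite_value G (- of_real \<rho>) + 1 / 2)) \<and>
      ((\<forall>n\<ge>2. even n \<longrightarrow> g n = real n powr \<rho>) \<longrightarrow> (\<forall>n\<ge>1. Q n = 0))"
proof -
  define \<delta> where "\<delta> = min \<epsilon> 1"
  have two_powr_\<rho>: "2 powr \<rho> = \<alpha> + \<beta>"
    using assms(1-3) by simp
  have "(\<lambda>n. g n - real n powr \<rho>) \<in> O(\<lambda>n. real n powr (\<rho> - \<epsilon>))"
    using assms(7,9)
    by (subst landau_o.big.in_cong[where g = g\<^sub>0]) (auto intro: eventually_sequentiallyI[of 2])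
  also have "(\<lambda>n. real n powr (\<rho> - \<epsilon>)) \<in> O(\<lambda>n. real n powr (\<rho> - \<delta>))"
    by (simp add: powr_bigo_iff filterlim_real_sequentially \<delta>_def)
  finally interpret critical_divide_and_conquer \<alpha> \<beta> \<phi> f g \<rho> \<delta>
    using assms two_powr_\<rho> by unfold_locales (auto simp: \<delta>_def)
  show ?thesis
    unfolding \<delta>_def[symmetric]
    by (intro exI[of _ periodic_part] exI[of _ remainder] exI[of _ "mellin_extension \<rho>"]
          conjI allI impI)
       (rule continuous_on_periodic_part periodic_part_plus_1 remainder_smallo solution_expansion
          mellin_powr_times_one_plus_absolutely_integrable[OF interpolated_toll]
          mellin_powr_times_one_plus[OF interpolated_toll, symmetric]
          meromorphic_mellin_extension holomorphic_mellin_extension is_pole_mellin_extension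
          zorder_mellin_extension fourier_coeff_expansion remainder_eq_0; assumption?)+
qed

end
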